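(* Assume that $P(x,y)>0$ for all $x,y\in X$ and that there is a constant $C_*\ge 1$ with $P_2(x,y)\le C_*P(x,y)$ for all $x,y\in X$; that $C_-:=\inf_{x\in X}P(x,x)>0$; that $\sup_{x,y\in X}P(x,y)/\mu(y)<\infty$; and that the potential $V$ is confining. Let $(B_n)_{n\in\mathbb N}$ be an arbitrary exhausting sequence consisting of finite sets such that $V$ is increasing with respect to $(B_n)_{n\in\mathbb N}$. Set $B_\infty:=X$, let $x_0\in X$ be a fixed reference point and let $C=\max\{3C_*,C_-^{-1}\}$. For an arbitrary finite set $D\supseteq\{z\in X:\lambda_0V(z)\le C\}$ define $$D_n=D\cup\left\{z\in X:\lambda_0V(z)\ge C\left(\frac1{P(z,x_0)P(x_0,z)}\right)^{\frac1{n-1}}\right\},\quad n\ge2,$$ and $$A_1=B_1,\qquad A_n=B_{l(n)},\quad n\ge2,\qquad\text{where } l(n):=\sup\{k\in\mathbb N:B_k\subseteq D_n\}\quad(\sup\emptyset:=1).$$ Then $(A_n)_{n\in\mathbb N}$ is an exhausting sequence and there exists a constant $c>0$ such that $$u_n(x,y)\le c\,\lambda_0^n\varphi_0(x)\widehat\varphi_0(y)\quad\text{whenever } x\in A_n\text{ or }y\in A_n,\ n\in\mathbb N.$$ Equivalently, the semigroups $\{\mathcal U_n:n\in\mathbb N_0\}$ and $\{\widehat{\mathcal U}_n:n\in\mathbb N_0\}$ are pIUC with respect to $(A_n)_{n\in\mathbb N}$.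
   Context: $X$ is a countably infinite set, $\mathbb N=\{1,2,\dots\}$, $\mathbb N_0=\mathbb N\cup\{0\}$. $P:X\times X\to[0,1]$ is a (sub-)probability kernel, i.e. $\sum_{y\in X}P(x,y)\le1$ for all $x$. It is assumed throughout that there are a (sub-)probability kernel $\widehat P:X\times X\to[0,1]$ and a measure $\mu:X\to(0,\infty)$ with $\mu(x)P(x,y)=\mu(y)\widehat P(y,x)$ for all $x,y\in X$. Put $p(x,y)=P(x,y)/\mu(y)$ and $P_2(x,y)=\sum_{z\in X}P(x,z)P(z,y)$. A potential is a function $V:X\to(0,\infty)$ with $\inf_{x\in X}V(x)>0$ (standing assumption). It is confining if for every $M\in\mathbb N$ there is a finite set $K_M\subset X$ with $V(x)\ge M$ for all $x\in X\setminus K_M$. Let $\mathcal U f(x)=\frac1{V(x)}\sum_{y}P(x,y)f(y)$ and $\widehat{\mathcal U}f(x)=\sum_y\widehat P(x,y)\frac1{V(y)}f(y)$; these are mutually adjoint on $\ell^2(\mu)$. Let $\mathcal U_n=\mathcal U^n$, $\widehat{\mathcal U}_n=\widehat{\mathcal U}^n$, with kernels with respect to $\mu$ given by $u_1(x,y)=p(x,y)/V(x)$, $u_{n+1}(x,y)=\sum_zu_n(x,z)u_1(z,y)\mu(z)$ and $\widehat u_n(x,y)=u_n(y,x)$. Under the hypotheses of the claim, $\mathcal U,\widehat{\mathcal U}$ are compact on $\ell^2(\mu)$ and $\lambda_0:=\sup_{\lambda\in\sigma(\mathcal U)}|\lambda|=\sup_{\lambda\in\sigma(\widehat{\mathcal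 U})}|\lambda|>0$ is a simple eigenvalue of both; $\varphi_0,\widehat\varphi_0$ denote the corresponding strictly positive eigenfunctions, $\mathcal U\varphi_0=\lambda_0\varphi_0$, $\widehat{\mathcal U}\widehat\varphi_0=\lambda_0\widehat\varphi_0$, normalized by $\|\varphi_0\|_{\ell^2(\mu)}=\|\widehat\varphi_0\|_{\ell^2(\mu)}=1$. A sequence $(A_n)_{n\in\mathbb N}$ of subsets of $X$ is exhausting if $A_n\subseteq A_{n+1}$ and $\bigcup_nA_n=X$. Its first appearance function is $\alpha(x)=\min\{n\in\mathbb N:x\in A_n\}$. $V$ is increasing with respect to $(A_n)$ if $V(x)\le V(y)$ whenever $\alpha(x)<\alpha(y)$. $\{\mathcal U_n\}$ is progressively intrinsically ultracontractive (pIUC) with respect to an exhausting sequence $(A_n)$ if there are $n_0\in\mathbb N$ and $c>0$ with $u_n(x,y)\le c\lambda_0^n\varphi_0(x)\widehat\varphi_0(y)$ for all $n\ge n_0$, $x\in A_n$, $y\in X$. $\{\widehat{\mathcal U}_n\}$ is pIUC with respect to $(A_n)$ if there are $n_0\in\mathbb N$ and $c>0$ with $\widehat u_n(x,y)\le c\lambda_0^n\widehat\varphi_0(x)\varphi_0(y)$ for all $n\ge n_0$, $x\in A_n$, $y\in X$. *)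

theory Defs
  imports "HOL-Analysis.Analysis" "HOL-Library.Extended_Nat"
begin

text \<open>
  The countable set \<open>X\<close> is the universe of the type \<open>'a\<close>. Sequences of sets indexed by
  \<open>{1, 2, \<dots>}\<close> are functions on \<^typ>\<open>nat\<close> whose value at \<open>0\<close> is never used.
\<close>

definition subprob_kernel :: "('a \<Rightarrow> 'a \<Rightarrow> real) \<Rightarrow> bool" where
  "subprob_kernel P \<longleftrightarrow>
     (\<forall>x y. 0 \<le> P x y \<and> P x y \<le> 1) \<and>
     (\<forall>x. P x summable_on UNIV \<and> (\<Sum>\<^sub>\<infinity>y. P x y) \<le> 1)"

definition two_step :: "('a \<Rightarrow> 'a \<Rightarrow> real) \<Rightarrow> 'a \<Rightarrow> 'a \<Rightarrow> real" where
  "two_step P x y = (\<Sum>\<^sub>\<infinity>z. P x z * P z y)"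

definition potential :: "('a \<Rightarrow> real) \<Rightarrow> bool" where
  "potential V \<longleftrightarrow> (\<forall>x. 0 < V x) \<and> 0 < (INF x. V x)"

definition confining :: "('a \<Rightarrow> real) \<Rightarrow> bool" where
  "confining V \<longleftrightarrow> (\<forall>M::nat. 1 \<le> M \<longrightarrow> (\<exists>K. finite K \<and> (\<forall>x. x \<notin> K \<longrightarrow> real M \<le> V x)))"

subsection \<open>Operators on the weighted sequence space and their spectrum\<close>

text \<open>
  As \<open>\<mu>\<close> is strictly positive, there are no null sets and elements of \<open>\<ell>\<^sup>2(\<mu>)\<close> are
  genuine functions.
\<close>

definition l2 :: "('a \<Rightarrow> real) \<Rightarrow> ('a \<Rightarrow> 'b::real_normed_vector) set" where
  "l2 \<mu> = {f. (\<lambda>x. (norm (f x))\<^sup>2 * \<mu> x) summable_on UNIV}"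

definition l2_norm :: "('a \<Rightarrow> real) \<Rightarrow> ('a \<Rightarrow> 'b::real_normed_vector) \<Rightarrow> real" where
  "l2_norm \<mu> f = sqrt (\<Sum>\<^sub>\<infinity>x. (norm (f x))\<^sup>2 * \<mu> x)"

definition bounded_op_l2 ::
    "('a \<Rightarrow> real) \<Rightarrow> (('a \<Rightarrow> complex) \<Rightarrow> ('a \<Rightarrow> complex)) \<Rightarrow> bool" where
  "bounded_op_l2 \<mu> T \<longleftrightarrow>
     (\<forall>f\<in>l2 \<mu>. T f \<in> l2 \<mu>) \<and>
     (\<forall>f\<in>l2 \<mu>. \<forall>g\<in>l2 \<mu>. T (\<lambda>x. f x + g x) = (\<lambda>x. T f x + T g x)) \<and>
     (\<forall>a. \<forall>f\<in>l2 \<mu>. T (\<lambda>x. a * f x) = (\<lambda>x. a * T f x)) \<and>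
     (\<exists>K. \<forall>f\<in>l2 \<mu>. l2_norm \<mu> (T f) \<le> K * l2_norm \<mu> f)"

text \<open>
  The complement of the set of those \<open>z\<close> for which \<open>zI - T\<close> has a bounded two-sided
  inverse on the complex Hilbert space \<open>\<ell>\<^sup>2(\<mu>)\<close>.
\<close>

definition spectrum_l2 ::
    "('a \<Rightarrow> real) \<Rightarrow> (('a \<Rightarrow> complex) \<Rightarrow> ('a \<Rightarrow> complex)) \<Rightarrow> complex set" where
  "spectrum_l2 \<mu> T =
     {z. \<not> (\<exists>R. bounded_op_l2 \<mu> R \<and>
               (\<forall>f\<in>l2 \<mu>. R (\<lambda>x. z * f x - T f x) = f \<and>
                          (\<lambda>x. z * R f x - T (R f) x) = f))}"

text \<open>
  The operators are defined for functions with values in any real normed space, so that they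
  act both on real eigenfunctions and on the complex space carrying the spectrum.
\<close>

definition op_U ::
    "('a \<Rightarrow> 'a \<Rightarrow> real) \<Rightarrow> ('a \<Rightarrow> real) \<Rightarrow> ('a \<Rightarrow> 'b::real_normed_vector) \<Rightarrow> 'a \<Rightarrow> 'b" where
  "op_U P V f x = (1 / V x) *\<^sub>R (\<Sum>\<^sub>\<infinity>y. P x y *\<^sub>R f y)"

definition op_U_hat ::
    "('a \<Rightarrow> 'a \<Rightarrow> real) \<Rightarrow> ('a \<Rightarrow> real) \<Rightarrow> ('a \<Rightarrow> 'b::real_normed_vector) \<Rightarrow> 'a \<Rightarrow> 'b" where
  "op_U_hat Ph V f x = (\<Sum>\<^sub>\<infinity>y. (Ph x y * (1 / V y)) *\<^sub>R f y)"

definition lambda0 :: "('a \<Rightarrow> real) \<Rightarrow> ('a \<Rightarrow> 'a \<Rightarrow> real) \<Rightarrow> ('a \<Rightarrow> real) \<Rightarrow> real" where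
  "lambda0 \<mu> P V = (SUP z\<in>spectrum_l2 \<mu> (op_U P V). cmod z)"

text \<open>
  \<open>kernel_u \<mu> P V n\<close> is the kernel of the \<open>n\<close>-th power of \<open>op_U P V\<close> with respect to \<open>\<mu>\<close>;
  at \<open>n = 0\<close> this is the kernel of the identity.
\<close>

fun kernel_u ::
    "('a \<Rightarrow> real) \<Rightarrow> ('a \<Rightarrow> 'a \<Rightarrow> real) \<Rightarrow> ('a \<Rightarrow> real) \<Rightarrow> nat \<Rightarrow> 'a \<Rightarrow> 'a \<Rightarrow> real" where
  "kernel_u \<mu> P V 0 x y = (if x = y then 1 / \<mu> x else 0)"
| "kernel_u \<mu> P V (Suc 0) x y = (P x y / \<mu> y) / V x"
| "kernel_u \<mu> P V (Suc (Suc n)) x y =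
     (\<Sum>\<^sub>\<infinity>z. kernel_u \<mu> P V (Suc n) x z * kernel_u \<mu> P V (Suc 0) z y * \<mu> z)"

definition kernel_u_hat ::
    "('a \<Rightarrow> real) \<Rightarrow> ('a \<Rightarrow> 'a \<Rightarrow> real) \<Rightarrow> ('a \<Rightarrow> real) \<Rightarrow> nat \<Rightarrow> 'a \<Rightarrow> 'a \<Rightarrow> real" where
  "kernel_u_hat \<mu> P V n x y = kernel_u \<mu> P V n y x"

subsection \<open>Exhausting sequences and progressive intrinsic ultracontractivity\<close>

definition exhausting :: "(nat \<Rightarrow> 'a set) \<Rightarrow> bool" where
  "exhausting A \<longleftrightarrow> (\<forall>n\<ge>1. A n \<subseteq> A (Suc n)) \<and> (\<Union>n\<in>{1..}. A n) = UNIV"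

definition first_appearance :: "(nat \<Rightarrow> 'a set) \<Rightarrow> 'a \<Rightarrow> nat" where
  "first_appearance A x = (LEAST n. 1 \<le> n \<and> x \<in> A n)"

definition increasing_wrt :: "('a \<Rightarrow> real) \<Rightarrow> (nat \<Rightarrow> 'a set) \<Rightarrow> bool" where
  "increasing_wrt V A \<longleftrightarrow>
     (\<forall>x y. first_appearance A x < first_appearance A y \<longrightarrow> V x \<le> V y)"

definition with_infinity :: "(nat \<Rightarrow> 'a set) \<Rightarrow> enat \<Rightarrow> 'a set" where
  "with_infinity B k = (case k of enat j \<Rightarrow> B j | \<infinity> \<Rightarrow> UNIV)"

text \<open>
  The supremum of all \<open>k\<close> with \<open>B k\<close> contained in \<open>S\<close>; it is \<open>\<infinity>\<close> when there are
  infinitely many such \<open>k\<close>, and \<open>1\<close> by convention when there are none.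
\<close>

definition largest_index :: "(nat \<Rightarrow> 'a set) \<Rightarrow> 'a set \<Rightarrow> enat" where
  "largest_index B S =
     (let I = {k. 1 \<le> k \<and> B k \<subseteq> S} in if I = {} then 1 else (SUP k\<in>I. enat k))"

text \<open>
  \<open>pIUC w lam \<phi> \<psi> A\<close>, for a family of kernels \<open>w\<close>, its leading eigenvalue \<open>lam\<close> and the
  positive eigenfunctions \<open>\<phi>\<close> of the operator and \<open>\<psi>\<close> of its adjoint.
\<close>

definition pIUC ::
    "(nat \<Rightarrow> 'a \<Rightarrow> 'a \<Rightarrow> real) \<Rightarrow> real \<Rightarrow> ('a \<Rightarrow> real) \<Rightarrow> ('a \<Rightarrow> real) \<Rightarrow> (nat \<Rightarrow> 'a set) \<Rightarrow> bool" where
  "pIUC w lam \<phi> \<psi> A \<longleftrightarrow>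
     (\<exists>n0\<ge>1. \<exists>c>0. \<forall>n\<ge>n0. \<forall>x\<in>A n. \<forall>y. w n x y \<le> c * lam ^ n * \<phi> x * \<psi> y)"

end

theory Submission imports Defs
begin

text \<open>
  Put \<open>W = \<lambda>\<^sub>0 V\<close>. Up to the factor \<open>V x \<mu> y / \<lambda>\<^sub>0\<^sup>n\<close>, the kernel \<open>u\<^sub>n\<^sub>+\<^sub>1 x y\<close> is the sum over all
  paths with \<open>n\<close> intermediate points of products of \<open>P\<close> along the steps and \<open>1 / W\<close> at the
  intermediate points. The eigenfunction equations bound \<open>P x x\<^sub>0 / V x\<close> by \<open>\<phi>\<^sub>0 x\<close> and
  \<open>P x\<^sub>0 y / \<mu> y\<close> by \<open>\<phi>h\<^sub>0 y\<close>, so it suffices to bound path sums by multiples of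
  \<open>P x x\<^sub>0 * P x\<^sub>0 y\<close>. Paths that meet a finite set outside of which \<open>W > C\<close> satisfy this for all
  \<open>x\<close> and \<open>y\<close>, because \<open>W \<phi>\<^sub>0\<close> is dominated by \<open>P x x\<^sub>0\<close>. For paths avoiding that set, a
  Young-type inequality concentrates the whole weight \<open>W\<^sup>-\<^sup>n\<close> on a single intermediate point
  \<open>z\<close>. If \<open>z\<close> lies in \<open>A\<^sub>n\<^sub>+\<^sub>1\<close>, the definition of \<open>D\<^sub>n\<^sub>+\<^sub>1\<close> gives
  \<open>(C / W z)\<^sup>n \<le> P z x\<^sub>0 * P x\<^sub>0 z\<close>; otherwise monotonicity of \<open>V\<close> allows replacing \<open>W z\<close> by the
  value of \<open>W\<close> at the endpoint in \<open>A\<^sub>n\<^sub>+\<^sub>1\<close>.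
\<close>

section \<open>Sums and an elementary inequality in the extended nonnegative reals\<close>

text \<open>With values in \<open>ennreal\<close> every sum exists and sums may be interchanged
  freely, so the estimates on path sums carry no summability conditions.\<close>

abbreviation esum :: "('a \<Rightarrow> ennreal) \<Rightarrow> ennreal" where
  "esum f \<equiv> integral\<^sup>N (count_space UNIV) f"

lemma esum_swap:
  fixes f :: "'a \<Rightarrow> 'b \<Rightarrow> ennreal"
  shows "esum (\<lambda>x. esum (\<lambda>y. f x y)) = esum (\<lambda>y. esum (\<lambda>x. f x y))"
  using nn_integral_fst_count_space[of "\<lambda>(x, y). f x y"]
    nn_integral_snd_count_space[of "\<lambda>(x, y). f x y"] by simp

lemma esum_split:
  assumes "finite D"
  shows "esum f = sum f D + esum (\<lambda>z. f z * indicator (- D) z)"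
proof -
  have "esum f = esum (\<lambda>z. f z * indicator D z + f z * indicator (- D) z)"
    by (intro nn_integral_cong) (simp split: split_indicator)
  also have "\<dots> = esum (\<lambda>z. f z * indicator D z) + esum (\<lambda>z. f z * indicator (- D) z)"
    by (simp add: nn_integral_add)
  also have "esum (\<lambda>z. f z * indicator D z) = sum f D"
    using assms by (simp add: nn_integral_count_space_indicator[symmetric]
        nn_integral_count_space_finite)
  finally show ?thesis .
qed

text \<open>Each \<open>g z\<close> is at most the whole sum of \<open>g\<close>. This later
  decouples a sum over one intermediate point into two independent two-step sums.\<close>

lemma esum_mult_le: "esum (\<lambda>z. f z * g z) \<le> esum f * esum g"
proof -
  have "esum (\<lambda>z. f z * g z) \<le> esum (\<lambda>z. f z * esum g)"
    by (intro nn_integral_mono mult_left_mono nn_integral_ge_point) auto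
  then show ?thesis by (simp add: nn_integral_multc)
qed

lemma esum_ennreal:
  assumes "f summable_on UNIV" "\<And>x. 0 \<le> f x"
  shows "esum (\<lambda>x. ennreal (f x)) = ennreal (infsum f UNIV)"
proof -
  have "(\<lambda>x. norm (f x)) summable_on UNIV"
    using assms by simp
  then have "Infinite_Set_Sum.abs_summable_on f UNIV"
    using abs_summable_equivalent by blast
  then show ?thesis
    using nn_integral_conv_infsetsum[of f UNIV] infsetsum_infsum[of f UNIV] assms(2) by simp
qed

text \<open>Without summability \<open>infsum\<close> takes the default value 0 and the bound is
  trivial. Kernels defined by \<open>infsum\<close> can thus be bounded above before their
  convergence is known.\<close>

lemma ennreal_infsum_le:
  assumes "\<And>x. 0 \<le> f x"
  shows "ennreal (infsum f UNIV) \<le> esum (\<lambda>x. ennreal (f x))"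
  using esum_ennreal[of f] assms by (cases "f summable_on UNIV") (auto simp: infsum_not_exists)

text \<open>The left side is at most the larger of \<open>a\<close> and \<open>b\<close> to the
  power \<open>Suc n\<close>, and the right side contains that power. This is the Young-type
  inequality that merges the weights of a path.\<close>

lemma power_mult_le_power_add:
  fixes a b :: ennreal
  shows "a ^ n * b \<le> a ^ Suc n + b ^ Suc n"
proof (cases "a \<le> b")
  case True
  then have "a ^ n * b \<le> b ^ n * b" by (intro mult_right_mono power_mono) auto
  then show ?thesis by (auto simp: mult.commute intro: add_increasing)
next
  case False
  then have "a ^ n * b \<le> a ^ n * a" by (intro mult_left_mono) auto
  then show ?thesis by (auto simp: mult.commute intro: add_increasing2)
qed

section \<open>Path sums and the consequences of the two-step bound\<close>

text \<open>The endpoints carry no weight, only the \<open>n\<close> intermediate points do; hence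
  index \<open>n\<close> here belongs to the kernel with index \<open>n + 1\<close>.\<close>

fun path_kernel ::
    "('a \<Rightarrow> 'a \<Rightarrow> ennreal) \<Rightarrow> ('a \<Rightarrow> ennreal) \<Rightarrow> nat \<Rightarrow> 'a \<Rightarrow> 'a \<Rightarrow> ennreal" where
  "path_kernel Q w 0 x y = Q x y"
| "path_kernel Q w (Suc n) x y = esum (\<lambda>z. path_kernel Q w n x z * w z * Q z y)"

text \<open>Summing a path kernel against \<open>w * \<psi>\<close> reproduces \<open>\<psi>\<close>
  for every length, and a single term is at most the sum. The gain is a bound that does not depend
  on \<open>n\<close>.\<close>

lemma path_kernel_eigen_le:
  assumes eig: "\<And>x. \<psi> x = esum (\<lambda>z. Q x z * w z * \<psi> z)"
  shows "path_kernel Q w n x d * w d * \<psi> d \<le> \<psi> x"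
proof -
  have "esum (\<lambda>z. path_kernel Q w n x z * w z * \<psi> z) = \<psi> x"
  proof (induction n)
    case 0
    show ?case by (simp add: eig[symmetric])
  next
    case (Suc n)
    have "esum (\<lambda>z. path_kernel Q w (Suc n) x z * w z * \<psi> z)
        = esum (\<lambda>z. esum (\<lambda>v. path_kernel Q w n x v * w v * (Q v z * w z * \<psi> z)))"
      by (simp add: nn_integral_multc[symmetric] mult.assoc)
    also have "\<dots> = esum (\<lambda>v. esum (\<lambda>z. path_kernel Q w n x v * w v * (Q v z * w z * \<psi> z)))"
      by (rule esum_swap)
    also have "\<dots> = esum (\<lambda>v. path_kernel Q w n x v * w v * \<psi> v)"
      by (simp add: nn_integral_cmult eig[symmetric])
    finally show ?case using Suc by simp
  qed
  then show ?thesis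
    using nn_integral_ge_point[of d UNIV "\<lambda>z. path_kernel Q w n x z * w z * \<psi> z"] by simp
qed

locale two_step_regular =
  fixes Q :: "'a \<Rightarrow> 'a \<Rightarrow> ennreal" and c :: ennreal
  assumes two_step_le: "esum (\<lambda>z. Q x z * Q z y) \<le> c * Q x y"
begin

lemma esum_weighted_le:
  assumes "\<And>z. w z \<le> b"
  shows "esum (\<lambda>z. Q x z * w z * Q z y) \<le> b * c * Q x y"
proof -
  have "esum (\<lambda>z. Q x z * w z * Q z y) \<le> esum (\<lambda>z. b * (Q x z * Q z y))"
  proof (intro nn_integral_mono)
    fix z
    have "w z * (Q x z * Q z y) \<le> b * (Q x z * Q z y)"
      using assms by (intro mult_right_mono) auto
    then show "Q x z * w z * Q z y \<le> b * (Q x z * Q z y)" by (simp add: ac_simps)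
  qed
  also have "\<dots> = b * esum (\<lambda>z. Q x z * Q z y)" by (simp add: nn_integral_cmult)
  also have "\<dots> \<le> b * (c * Q x y)" by (intro mult_left_mono two_step_le) auto
  finally show ?thesis by (simp add: mult.assoc)
qed

text \<open>Removing the last intermediate point costs \<open>b\<close> for its weight and
  \<open>c\<close> for joining its two steps into one.\<close>

lemma path_kernel_le:
  assumes "\<And>z. w z \<le> b"
  shows "path_kernel Q w n x y \<le> (b * c) ^ n * Q x y"
proof (induction n arbitrary: y)
  case (Suc n)
  have "path_kernel Q w (Suc n) x y \<le> esum (\<lambda>z. (b * c) ^ n * (Q x z * w z * Q z y))"
    unfolding path_kernel.simps
  proof (intro nn_integral_mono)
    fix z
    have "path_kernel Q w n x z * (w z * Q z y) \<le> (b * c) ^ n * Q x z * (w z * Q z y)"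
      using Suc by (intro mult_right_mono) auto
    then show "path_kernel Q w n x z * w z * Q z y \<le> (b * c) ^ n * (Q x z * w z * Q z y)"
      by (simp add: mult.assoc)
  qed
  also have "\<dots> = (b * c) ^ n * esum (\<lambda>z. Q x z * w z * Q z y)" by (simp add: nn_integral_cmult)
  also have "\<dots> \<le> (b * c) ^ n * (b * c * Q x y)"
    using esum_weighted_le[OF assms] by (intro mult_left_mono) auto
  finally show ?case by (simp add: ac_simps)
qed simp

text \<open>Adding a point \<open>z\<close> to a path whose weight sits at \<open>v\<close> gives
  the mixed weight \<open>w v ^ Suc k * w z\<close>. Young's inequality replaces it by pure powers
  at \<open>v\<close> and at \<open>z\<close>; in either term the point left without weight is
  summed out at cost \<open>c\<close>, so one step costs \<open>2 * c\<close>.\<close>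

lemma path_kernel_Suc_le:
  "path_kernel Q w (Suc k) x y \<le> (2 * c) ^ k * esum (\<lambda>z. Q x z * w z ^ Suc k * Q z y)"
proof (induction k arbitrary: y)
  case (Suc k)
  let ?F = "esum (\<lambda>z. Q x z * w z ^ Suc (Suc k) * Q z y)"
  have "path_kernel Q w (Suc (Suc k)) x y
      \<le> esum (\<lambda>z. (2 * c) ^ k * esum (\<lambda>v. Q x v * w v ^ Suc k * Q v z) * w z * Q z y)"
    by (subst path_kernel.simps, intro nn_integral_mono mult_right_mono Suc) auto
  also have "\<dots> = (2 * c) ^ k * esum (\<lambda>z. esum (\<lambda>v. Q x v * w v ^ Suc k * Q v z) * (w z * Q z y))"
    by (simp add: nn_integral_cmult mult.assoc)
  also have "\<dots> = (2 * c) ^ k *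
      esum (\<lambda>z. esum (\<lambda>v. (w v ^ Suc k * w z) * (Q x v * Q v z * Q z y)))"
    by (subst nn_integral_multc[symmetric]) (auto simp: ac_simps)
  also have "\<dots> \<le> (2 * c) ^ k * esum (\<lambda>z. esum (\<lambda>v.
      (w v ^ Suc (Suc k) + w z ^ Suc (Suc k)) * (Q x v * Q v z * Q z y)))"
    by (intro mult_left_mono nn_integral_mono mult_right_mono power_mult_le_power_add) auto
  also have "\<dots> = (2 * c) ^ k *
      (esum (\<lambda>z. esum (\<lambda>v. Q x v * w v ^ Suc (Suc k) * (Q v z * Q z y))) +
       esum (\<lambda>z. esum (\<lambda>v. Q x v * Q v z) * (w z ^ Suc (Suc k) * Q z y)))"
    by (subst nn_integral_add[symmetric], simp, simp, subst nn_integral_multc[symmetric], simp,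
        subst nn_integral_add[symmetric]) (auto simp: distrib_left distrib_right ac_simps)
  also have "\<dots> \<le> (2 * c) ^ k * (c * ?F + c * ?F)"
  proof (intro mult_left_mono add_mono)
    \<comment> \<open>Here the weight sits at \<open>v\<close>, so the order of summation is
      exchanged to sum out \<open>z\<close> first; in the second term \<open>v\<close> is already
      innermost.\<close>
    have "esum (\<lambda>z. esum (\<lambda>v. Q x v * w v ^ Suc (Suc k) * (Q v z * Q z y)))
        = esum (\<lambda>v. esum (\<lambda>z. Q x v * w v ^ Suc (Suc k) * (Q v z * Q z y)))"
      by (rule esum_swap)
    also have "\<dots> = esum (\<lambda>v. Q x v * w v ^ Suc (Suc k) * esum (\<lambda>z. Q v z * Q z y))"
      by (simp add: nn_integral_cmult)
    also have "\<dots> \<le> esum (\<lambda>v. Q x v * w v ^ Suc (Suc k) * (c * Q v y))"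
      by (intro nn_integral_mono mult_left_mono two_step_le) auto
    also have "\<dots> = c * ?F" by (simp add: nn_integral_cmult[symmetric] ac_simps)
    finally show "esum (\<lambda>z. esum (\<lambda>v. Q x v * w v ^ Suc (Suc k) * (Q v z * Q z y))) \<le> c * ?F" .
    have "esum (\<lambda>z. esum (\<lambda>v. Q x v * Q v z) * (w z ^ Suc (Suc k) * Q z y))
        \<le> esum (\<lambda>z. c * Q x z * (w z ^ Suc (Suc k) * Q z y))"
      by (intro nn_integral_mono mult_right_mono two_step_le) auto
    also have "\<dots> = c * ?F" by (simp add: nn_integral_cmult[symmetric] ac_simps)
    finally show "esum (\<lambda>z. esum (\<lambda>v. Q x v * Q v z) * (w z ^ Suc (Suc k) * Q z y)) \<le> c * ?F" .
  qed auto
  also have "\<dots> = (2 * c) ^ Suc k * ?F"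
    by (simp add: mult_2 distrib_left distrib_right ac_simps)
  finally show ?case .
qed simp

text \<open>The term with \<open>Q z a * Q a z\<close> separates into the two-step sums from
  \<open>x\<close> to \<open>a\<close> and from \<open>a\<close> to \<open>y\<close>. The other term
  has a constant factor, a loop from the endpoint \<open>u\<close> through \<open>a\<close>;
  inserting it at \<open>u\<close> turns the step from \<open>x\<close> to \<open>y\<close> into a
  passage through \<open>a\<close>. Each term contributes \<open>c\<^sup>2\<close>, and
  \<open>r\<close> absorbs \<open>(2 * c) ^ k\<close>.\<close>

lemma path_kernel_Suc_le_rank_one:
  assumes w: "\<And>z. w z ^ Suc k \<le> r * (Q z a * Q a z + Q u a * Q a u)"
    and u: "u = x \<or> u = y" and r: "(2 * c) ^ k * r \<le> 1"
  shows "path_kernel Q w (Suc k) x y \<le> 2 * c\<^sup>2 * Q x a * Q a y"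
proof -
  let ?s = "Q u a * Q a u"
  have "esum (\<lambda>z. Q x z * w z ^ Suc k * Q z y)
      \<le> esum (\<lambda>z. r * ((Q x z * Q z a) * (Q a z * Q z y) + ?s * (Q x z * Q z y)))"
  proof (intro nn_integral_mono)
    fix z
    have "w z ^ Suc k * (Q x z * Q z y) \<le> r * (Q z a * Q a z + ?s) * (Q x z * Q z y)"
      by (intro mult_right_mono w) auto
    then show "Q x z * w z ^ Suc k * Q z y
        \<le> r * ((Q x z * Q z a) * (Q a z * Q z y) + ?s * (Q x z * Q z y))"
      by (simp add: distrib_left distrib_right ac_simps)
  qed
  also have "\<dots> = r * (esum (\<lambda>z. (Q x z * Q z a) * (Q a z * Q z y))
      + ?s * esum (\<lambda>z. Q x z * Q z y))"
    by (simp add: nn_integral_add nn_integral_cmult)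
  also have "\<dots> \<le> r * ((c * Q x a) * (c * Q a y) + ?s * (c * Q x y))"
    by (intro mult_left_mono add_mono order_trans[OF esum_mult_le] mult_mono two_step_le) auto
  also have "\<dots> \<le> r * (c * Q x a * (c * Q a y) + c * Q x a * (c * Q a y))"
  proof (intro mult_left_mono add_mono)
    have step: "Q s t * Q t v \<le> c * Q s v" for s t v
      using nn_integral_ge_point[of t UNIV "\<lambda>t. Q s t * Q t v"] two_step_le[of s v]
      by (meson UNIV_I order_trans)
    from u show "?s * (c * Q x y) \<le> c * Q x a * (c * Q a y)"
    proof
      assume "u = x"
      then have "?s * (c * Q x y) = c * Q x a * (Q a x * Q x y)" by (simp add: ac_simps)
      also have "\<dots> \<le> c * Q x a * (c * Q a y)" by (intro mult_left_mono step) auto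
      finally show ?thesis .
    next
      assume "u = y"
      then have "?s * (c * Q x y) = (Q x y * Q y a) * (c * Q a y)" by (simp add: ac_simps)
      also have "\<dots> \<le> c * Q x a * (c * Q a y)" by (intro mult_right_mono step) auto
      finally show ?thesis .
    qed
  qed auto
  finally have "esum (\<lambda>z. Q x z * w z ^ Suc k * Q z y)
      \<le> r * (c * Q x a * (c * Q a y) + c * Q x a * (c * Q a y))" .
  then have "(2 * c) ^ k * esum (\<lambda>z. Q x z * w z ^ Suc k * Q z y)
      \<le> (2 * c) ^ k * (r * (c * Q x a * (c * Q a y) + c * Q x a * (c * Q a y)))"
    by (intro mult_left_mono) auto
  also have "\<dots> = (2 * c) ^ k * r * (2 * c\<^sup>2 * Q x a * Q a y)"
    by (simp add: power2_eq_square mult_2 distrib_left distrib_right ac_simps)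
  also have "\<dots> \<le> 1 * (2 * c\<^sup>2 * Q x a * Q a y)" by (intro mult_right_mono r) auto
  finally show ?thesis using path_kernel_Suc_le[of w k x y] by simp
qed

text \<open>
  The sum over paths hitting \<open>D\<close> is controlled by the last visit to \<open>D\<close>: up to that visit the
  eigenfunction \<open>\<psi>\<close> bounds the paths uniformly in their length, and after it each step costs a
  factor \<open>b * c \<le> 1/3\<close>.
\<close>

lemma path_kernel_le_avoiding:
  assumes D: "finite D"
    and QD: "\<And>x d. d \<in> D \<Longrightarrow> Q x d \<le> K * Q x a" "\<And>y d. d \<in> D \<Longrightarrow> Q d y \<le> K * Q a y"
    and K: "K < top"
    and wb: "\<And>z. z \<notin> D \<Longrightarrow> w z \<le> b" and b: "3 * (b * c) \<le> 1"
    and w_fin: "\<And>z. w z < top"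
    and eig: "\<And>x. \<psi> x = esum (\<lambda>z. Q x z * w z * \<psi> z)"
    and \<psi>: "\<And>x. \<psi> x \<noteq> 0" "\<And>x. \<psi> x < top"
  obtains L where "L < top"
    "\<And>n x y. path_kernel Q w n x y
       \<le> path_kernel Q (\<lambda>z. w z * indicator (- D) z) n x y + L * Q x a * Q a y"
proof -
  define v where "v = (\<lambda>z. w z * indicator (- D) z)"
  have vb: "v z \<le> b" for z using wb by (simp add: v_def split: split_indicator)
  define M where "M = 3 * K * (\<Sum>d\<in>D. w d * \<psi> d)"
  \<comment> \<open>The part of the eigenvalue sum outside \<open>D\<close> is at most a third of
    \<open>\<psi> x\<close>, so \<open>\<psi> x\<close> is controlled by the part over
    \<open>D\<close>, where \<open>QD\<close> applies.\<close>
  have \<psi>_le: "\<psi> x \<le> M * Q x a" for x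
  proof -
    let ?S = "\<Sum>d\<in>D. Q x d * w d * \<psi> d"
    \<comment> \<open>Expanding \<open>\<psi> z\<close> once more by its equation puts
      \<open>z\<close> between two steps, so that it can be summed out.\<close>
    have "esum (\<lambda>z. Q x z * v z * \<psi> z)
        = esum (\<lambda>z. Q x z * v z * esum (\<lambda>u. Q z u * w u * \<psi> u))"
      by (intro nn_integral_cong arg_cong2[where f = "(*)"] refl eig)
    also have "\<dots> = esum (\<lambda>z. esum (\<lambda>u. Q x z * v z * Q z u * (w u * \<psi> u)))"
      by (simp add: nn_integral_cmult[symmetric] mult.assoc)
    also have "\<dots> = esum (\<lambda>u. esum (\<lambda>z. Q x z * v z * Q z u * (w u * \<psi> u)))"
      by (rule esum_swap)
    also have "\<dots> = esum (\<lambda>u. esum (\<lambda>z. Q x z * v z * Q z u) * (w u * \<psi> u))"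
      by (simp add: nn_integral_multc)
    also have "\<dots> \<le> esum (\<lambda>u. b * c * Q x u * (w u * \<psi> u))"
      by (intro nn_integral_mono mult_right_mono esum_weighted_le vb) auto
    also have "\<dots> = b * c * esum (\<lambda>u. Q x u * w u * \<psi> u)"
      by (simp add: nn_integral_cmult[symmetric] mult.assoc)
    also have "\<dots> = b * c * \<psi> x" by (simp add: eig[symmetric])
    finally have "3 * esum (\<lambda>z. Q x z * v z * \<psi> z) \<le> 3 * (b * c * \<psi> x)"
      by (intro mult_left_mono) auto
    also have "\<dots> \<le> 1 * \<psi> x"
      unfolding mult.assoc[symmetric] using b by (intro mult_right_mono) (auto simp: mult.assoc)
    finally have tail: "3 * esum (\<lambda>z. Q x z * v z * \<psi> z) \<le> \<psi> x" by simp
    have split: "\<psi> x = ?S + esum (\<lambda>z. Q x z * v z * \<psi> z)"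
      by (rule trans[OF eig], subst esum_split[OF D]) (simp add: v_def ac_simps)
    \<comment> \<open>The tail is to be absorbed into the left side. Subtraction in
      \<open>ennreal\<close> is delicate, so the identity is tripled and the finite summand
      \<open>\<psi> x\<close> is cancelled on both sides.\<close>
    have "\<psi> x + 2 * \<psi> x = 3 * \<psi> x"
      using distrib_right[of 1 2 "\<psi> x"] by simp
    also have "\<dots> = 3 * ?S + 3 * esum (\<lambda>z. Q x z * v z * \<psi> z)"
      using arg_cong[OF split, of "\<lambda>t. 3 * t"] by (simp only: distrib_left)
    also have "\<dots> \<le> 3 * ?S + \<psi> x" using tail by (intro add_left_mono)
    finally have "\<psi> x + 2 * \<psi> x \<le> \<psi> x + 3 * ?S" by (simp add: add.commute)
    then have "2 * \<psi> x \<le> 3 * ?S"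
      using \<psi>(2)[of x] by (auto simp: ennreal_add_left_cancel_le)
    then have "\<psi> x \<le> 3 * ?S"
      by (rule order_trans[rotated]) (simp add: mult_2)
    also have "\<dots> \<le> 3 * (\<Sum>d\<in>D. K * Q x a * (w d * \<psi> d))"
      unfolding mult.assoc[of "Q x _"]
      by (intro mult_left_mono sum_mono mult_right_mono QD) auto
    also have "\<dots> = M * Q x a" by (simp add: M_def sum_distrib_left ac_simps)
    finally show ?thesis .
  qed
  have M: "M < top"
    using K w_fin \<psi>(2) by (auto simp: M_def ennreal_mult_less_top D)
  define N where "N = (\<Sum>d\<in>D. M / \<psi> d)"
  have N: "N < top"
    using M \<psi> by (auto simp: N_def D less_top[symmetric] ennreal_divide_eq_top_iff)
  \<comment> \<open>Dividing by \<open>\<psi> d\<close>, which is neither 0 nor infinite, leaves a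
    bound uniform in \<open>n\<close>; summing the quotients over the finite set \<open>D\<close>
    makes \<open>N\<close> uniform in \<open>d\<close>.\<close>
  have hit: "path_kernel Q w n x d * w d \<le> N * Q x a" if "d \<in> D" for n x d
  proof -
    have "path_kernel Q w n x d * w d * \<psi> d \<le> M * Q x a"
      by (rule order_trans[OF path_kernel_eigen_le[OF eig] \<psi>_le])
    then have "path_kernel Q w n x d * w d * \<psi> d / \<psi> d \<le> M * Q x a / \<psi> d"
      by (rule divide_right_mono_ennreal)
    also have "path_kernel Q w n x d * w d * \<psi> d / \<psi> d = path_kernel Q w n x d * w d"
      using \<psi> by (intro ennreal_mult_divide_eq) (auto simp: less_top)
    also have "M * Q x a / \<psi> d = M / \<psi> d * Q x a"
      by (simp add: divide_ennreal_def ac_simps)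
    also have "\<dots> \<le> N * Q x a"
      unfolding N_def using D that by (intro mult_right_mono member_le_sum) auto
    finally show ?thesis .
  qed
  define R where "R = of_nat (card D) * N * K"
  have R: "R < top" using N K by (simp add: R_def ennreal_mult_less_top of_nat_less_top)
  \<comment> \<open>The constant \<open>3 * R\<close> closes the induction: a last intermediate
    point in \<open>D\<close> contributes \<open>R\<close>, and one outside \<open>D\<close> shrinks
    \<open>3 * R\<close> to at most \<open>R\<close>, so \<open>2 * R\<close> results.\<close>
  have "path_kernel Q w n x y \<le> path_kernel Q v n x y + 3 * R * Q x a * Q a y" for n x y
  proof (induction n arbitrary: y)
    case (Suc n)
    have "path_kernel Q w (Suc n) x y = (\<Sum>d\<in>D. path_kernel Q w n x d * w d * Q d y)
        + esum (\<lambda>z. path_kernel Q w n x z * v z * Q z y)"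
      by (simp, subst esum_split[OF D]) (simp add: v_def ac_simps)
    also have "\<dots> \<le> R * Q x a * Q a y + (path_kernel Q v (Suc n) x y + R * Q x a * Q a y)"
    proof (rule add_mono)
      have "(\<Sum>d\<in>D. path_kernel Q w n x d * w d * Q d y) \<le> (\<Sum>d\<in>D. N * Q x a * (K * Q a y))"
        by (intro sum_mono mult_mono hit QD) auto
      then show "(\<Sum>d\<in>D. path_kernel Q w n x d * w d * Q d y) \<le> R * Q x a * Q a y"
        by (simp add: R_def ac_simps)
      have "esum (\<lambda>z. path_kernel Q w n x z * v z * Q z y)
          \<le> esum (\<lambda>z. (path_kernel Q v n x z + 3 * R * Q x a * Q a z) * v z * Q z y)"
        by (intro nn_integral_mono mult_right_mono Suc) auto
      also have "\<dots> = path_kernel Q v (Suc n) x y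
          + 3 * R * Q x a * esum (\<lambda>z. Q a z * v z * Q z y)"
        by (simp add: distrib_right nn_integral_add nn_integral_cmult[symmetric] mult.assoc)
      also have "\<dots> \<le> path_kernel Q v (Suc n) x y + 3 * R * Q x a * (b * c * Q a y)"
        by (intro add_left_mono mult_left_mono esum_weighted_le vb) auto
      also have "3 * R * Q x a * (b * c * Q a y) = 3 * (b * c) * (R * Q x a * Q a y)"
        by (simp add: ac_simps)
      also have "\<dots> \<le> 1 * (R * Q x a * Q a y)" by (intro mult_right_mono b) auto
      finally show "esum (\<lambda>z. path_kernel Q w n x z * v z * Q z y)
          \<le> path_kernel Q v (Suc n) x y + R * Q x a * Q a y" by (simp add: add_left_mono)
    qed
    also have "\<dots> = path_kernel Q v (Suc n) x y + 2 * R * Q x a * Q a y"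
      by (simp add: mult_2 distrib_left distrib_right ac_simps)
    also have "\<dots> \<le> path_kernel Q v (Suc n) x y + 3 * R * Q x a * Q a y"
      by (intro add_left_mono mult_right_mono) auto
    finally show ?case .
  qed simp
  moreover have "3 * R < top" using R by (simp add: ennreal_mult_less_top)
  ultimately show thesis by (intro that[folded v_def])
qed

end

section \<open>Exhausting sequences and the largest admissible index\<close>

lemma exhausting_mono:
  assumes "exhausting B" "1 \<le> i" "i \<le> j"
  shows "B i \<subseteq> B j"
  using assms(3,2)
proof (induction j rule: dec_induct)
  case (step n)
  then show ?case using assms(1) unfolding exhausting_def by (meson dual_order.trans)
qed simp

lemma largest_index_ge:
  assumes "1 \<le> k" "B k \<subseteq> S"
  shows "enat k \<le> largest_index B S"
  using assms by (auto simp: largest_index_def Let_def intro!: SUP_upper)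

lemma one_le_largest_index: "1 \<le> largest_index B S"
proof (cases "{k. 1 \<le> k \<and> B k \<subseteq> S} = {}")
  case False
  then obtain k where k: "1 \<le> k" "B k \<subseteq> S" by auto
  have "1 \<le> enat k" using k(1) by (simp add: one_enat_def)
  then show ?thesis using largest_index_ge[of k B S, OF k] by (rule order_trans)
qed (auto simp: largest_index_def)

lemma largest_index_mono:
  assumes "S \<subseteq> T"
  shows "largest_index B S \<le> largest_index B T"
proof (cases "{k. 1 \<le> k \<and> B k \<subseteq> S} = {}")
  case True
  then have "largest_index B S = 1" by (simp add: largest_index_def)
  then show ?thesis by (simp add: one_le_largest_index)
next
  case False
  then show ?thesis
    using assms largest_index_ge[of _ B T]
    by (subst largest_index_def) (auto simp: Let_def intro!: SUP_least)
qed

lemma with_infinity_mono: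
  assumes "exhausting B" "1 \<le> i" "i \<le> j"
  shows "with_infinity B i \<subseteq> with_infinity B j"
  using assms(2,3) exhausting_mono[OF assms(1)]
  by (cases i; cases j) (simp_all add: with_infinity_def one_enat_def)

text \<open>Three cases: with no admissible index the convention selects \<open>B 1\<close>, which
  is why \<open>B 1\<close> appears on the right; with finitely many the supremum is attained; with
  infinitely many the sets \<open>B k\<close> force \<open>S\<close> to be everything.\<close>

lemma with_infinity_largest_index_subset:
  assumes B: "exhausting B"
  shows "with_infinity B (largest_index B S) \<subseteq> S \<union> B 1"
proof (cases "{k. 1 \<le> k \<and> B k \<subseteq> S} = {}")
  case True
  then show ?thesis by (simp add: largest_index_def with_infinity_def one_enat_def)
next
  case False
  let ?I = "{k. 1 \<le> k \<and> B k \<subseteq> S}"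
  have L: "largest_index B S = Sup (enat ` ?I)"
    unfolding largest_index_def Let_def using False by (rule if_not_P)
  show ?thesis
  proof (cases "finite ?I")
    case True
    then have "largest_index B S \<in> enat ` ?I"
      unfolding L using False by (subst Max_Sup[symmetric]) (auto intro!: Max_in)
    then show ?thesis by (auto simp: with_infinity_def)
  next
    case inf: False
    have "x \<in> S" for x
    proof -
      obtain i where i: "1 \<le> i" "x \<in> B i" using B by (fastforce simp: exhausting_def)
      obtain j where "i \<le> j" "j \<in> ?I" using inf by (meson infinite_nat_iff_unbounded_le)
      then show ?thesis using exhausting_mono[OF B i(1), of j] i(2) by auto
    qed
    then show ?thesis by auto
  qed
qed

text \<open>The existence of \<open>z\<close> excludes the index infinity. Then \<open>x\<close>
  appears no later than the index and \<open>z\<close> strictly later.\<close>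

lemma increasing_wrt_with_infinity:
  assumes B: "exhausting B" and V: "increasing_wrt V B" and i: "1 \<le> i"
    and x: "x \<in> with_infinity B i" and z: "z \<notin> with_infinity B i"
  shows "V x \<le> V z"
proof -
  obtain k where k: "i = enat k" "1 \<le> k"
    using z i by (cases i) (auto simp: with_infinity_def one_enat_def)
  have xk: "x \<in> B k" and zk: "z \<notin> B k" using x z by (auto simp: k with_infinity_def)
  have "\<exists>n. 1 \<le> n \<and> z \<in> B n" using B by (fastforce simp: exhausting_def)
  then have fz: "1 \<le> first_appearance B z \<and> z \<in> B (first_appearance B z)"
    unfolding first_appearance_def by (rule LeastI_ex)
  have "first_appearance B x \<le> k"
    unfolding first_appearance_def using xk k by (intro Least_le) auto
  also have "k < first_appearance B z"
    using fz zk exhausting_mono[OF B, of "first_appearance B z" k] by (meson not_less subsetD)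
  finally show ?thesis using V by (auto simp: increasing_wrt_def)
qed

text \<open>Since \<open>B k\<close> is finite, there is one index \<open>N\<close> by which all its
  points have entered the increasing sets \<open>S n\<close>. Then \<open>k\<close> is admissible
  for \<open>S N\<close>, and \<open>A N\<close> contains \<open>B k\<close>.\<close>

lemma exhausting_largest_index:
  assumes B: "exhausting B" "\<And>n. 1 \<le> n \<Longrightarrow> finite (B n)"
    and S: "\<And>n. 2 \<le> n \<Longrightarrow> S n \<subseteq> S (Suc n)" "\<And>z. \<exists>n\<ge>2. z \<in> S n"
    and A: "A 1 = B 1" "\<And>n. 2 \<le> n \<Longrightarrow> A n = with_infinity B (largest_index B (S n))"
  shows "exhausting A"
  unfolding exhausting_def
proof (intro conjI allI impI)
  fix n :: nat assume "1 \<le> n"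
  then consider "n = 1" | "2 \<le> n" by linarith
  then show "A n \<subseteq> A (Suc n)"
  proof cases
    case 1
    have "with_infinity B 1 \<subseteq> A 2"
      unfolding A(2)[OF order_refl] by (intro with_infinity_mono B one_le_largest_index order_refl)
    moreover have "A (Suc n) = A 2" using 1 by (simp add: numeral_2_eq_2)
    ultimately show ?thesis using 1 A(1) by (simp add: with_infinity_def one_enat_def)
  next
    case 2
    then show ?thesis
      by (simp add: A(2) with_infinity_mono B one_le_largest_index largest_index_mono S)
  qed
next
  have "x \<in> (\<Union>n\<in>{1..}. A n)" for x
  proof -
    obtain k where k: "1 \<le> k" "x \<in> B k" using B(1) by (fastforce simp: exhausting_def)
    obtain m where m: "\<And>z. 2 \<le> m z \<and> z \<in> S (m z)" using S(2) by metis
    define N where "N = Max (m ` B k)"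
    have "finite (m ` B k)" using B(2) k by auto
    then have mN: "m z \<le> N" if "z \<in> B k" for z using that by (auto simp: N_def)
    have N: "2 \<le> N" using m[of x] mN[OF k(2)] by simp
    have "S (m z) \<subseteq> S N" if "z \<in> B k" for z
      using mN[OF that]
    proof (induction N rule: dec_induct)
      case (step n)
      then show ?case using m[of z] S(1)[of n] by auto
    qed simp
    then have "B k \<subseteq> S N" using m by blast
    then have "enat k \<le> largest_index B (S N)" using k by (intro largest_index_ge)
    then have "with_infinity B (enat k) \<subseteq> A N"
      unfolding A(2)[OF N] using k by (intro with_infinity_mono B) (auto simp: one_enat_def)
    then show ?thesis using k N by (auto simp: with_infinity_def intro!: bexI[of _ N])
  qed
  then show "(\<Union>n\<in>{1..}. A n) = UNIV" by auto
qed

section \<open>The threshold in the definition of \<open>Dn\<close>\<close>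

text \<open>The exponent tends to 0, so the threshold tends to \<open>C\<close>, which lies strictly
  below \<open>t\<close>.\<close>

lemma threshold_eventually_less:
  fixes C q t :: real
  assumes "0 < q" "C < t"
  obtains n :: nat where "2 \<le> n" "C * q powr (1 / (real n - 1)) \<le> t"
proof -
  have "(\<lambda>m. C * q powr (inverse (real (Suc m)))) \<longlonglongrightarrow> C * q powr 0"
    using assms by (intro tendsto_intros LIMSEQ_inverse_real_of_nat) auto
  then have "\<forall>\<^sub>F m in sequentially. C * q powr (inverse (real (Suc m))) < t"
    using assms by (intro order_tendstoD) auto
  then obtain m where "C * q powr (inverse (real (Suc m))) < t"
    by (auto simp: eventually_sequentially)
  \<comment> \<open>The shift by 2 ensures \<open>2 \<le> n\<close> and turns \<open>n - 1\<close>
    into \<open>Suc m\<close>.\<close>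
  then show thesis by (intro that[of "m + 2"]) (auto simp: field_simps)
qed

lemma power_le_of_powr_le:
  fixes C q t :: real
  assumes C: "0 < C" and q: "0 < q" and le: "C * (1 / q) powr (1 / real (Suc k)) \<le> t"
  shows "(1 / t) ^ Suc k \<le> (1 / C) ^ Suc k * q"
proof -
  have pos: "0 < C * (1 / q) powr (1 / real (Suc k))" using C q by simp
  have root: "((1 / q) powr (1 / real (Suc k))) ^ Suc k = 1 / q"
    using q by (subst powr_realpow[symmetric]) (auto simp: powr_powr)
  have "(1 / t) ^ Suc k \<le> (1 / (C * (1 / q) powr (1 / real (Suc k)))) ^ Suc k"
    using pos le by (intro power_mono divide_left_mono) auto
  also have "\<dots> = (1 / C) ^ Suc k * q"
    using root by (simp only: power_divide power_mult_distrib power_one) simp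
  finally show ?thesis .
qed

section \<open>Kernels of the semigroup as path sums\<close>

lemma kernel_u_nonneg:
  assumes "\<And>x y. 0 \<le> P x y" "\<And>x. 0 < \<mu> x" "\<And>x. 0 < V x"
  shows "0 \<le> kernel_u \<mu> P V n x y"
  using assms
  by (induction \<mu> P V n x y rule: kernel_u.induct)
    (auto simp: less_imp_le intro!: infsum_nonneg mult_nonneg_nonneg)

text \<open>The measures of the intermediate points cancel, leaving \<open>V x\<close> from the
  start and \<open>\<mu> y\<close> from the end; \<open>lam ^ n\<close> compensates the factor
  \<open>1 / lam\<close> in each of the \<open>n\<close> weights. Only an upper bound is stated, so
  convergence of the sums defining the kernel need not be shown.\<close>

lemma kernel_u_le_path_kernel:
  assumes P: "\<And>x y. 0 \<le> P x y" and \<mu>: "\<And>x. 0 < \<mu> x" and V: "\<And>x. 0 < V x" and lam: "0 < lam"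
  shows "ennreal (kernel_u \<mu> P V (Suc n) x y) \<le> ennreal (lam ^ n / (V x * \<mu> y)) *
    path_kernel (\<lambda>x y. ennreal (P x y)) (\<lambda>z. ennreal (1 / (lam * V z))) n x y"
proof (induction n arbitrary: y)
  case 0
  show ?case using P \<mu>[of y] V[of x] by (simp add: ennreal_mult'[symmetric] mult.commute)
next
  case (Suc n)
  let ?p = "path_kernel (\<lambda>x y. ennreal (P x y)) (\<lambda>z. ennreal (1 / (lam * V z)))"
  note nonneg = kernel_u_nonneg[of P \<mu> V, OF P \<mu> V]
  have "ennreal (kernel_u \<mu> P V (Suc (Suc n)) x y)
      \<le> esum (\<lambda>z. ennreal (kernel_u \<mu> P V (Suc n) x z * kernel_u \<mu> P V (Suc 0) z y * \<mu> z))"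
    unfolding kernel_u.simps(3)
    by (intro ennreal_infsum_le mult_nonneg_nonneg nonneg) (simp add: \<mu> less_imp_le)
  also have "\<dots> \<le> esum (\<lambda>z. ennreal (lam ^ Suc n / (V x * \<mu> y)) *
      (?p n x z * ennreal (1 / (lam * V z)) * ennreal (P z y)))"
  proof (intro nn_integral_mono)
    fix z
    let ?k = "kernel_u \<mu> P V (Suc 0) z y * \<mu> z"
    have k: "0 \<le> ?k" by (intro mult_nonneg_nonneg nonneg less_imp_le \<mu>)
    have "ennreal (kernel_u \<mu> P V (Suc n) x z * kernel_u \<mu> P V (Suc 0) z y * \<mu> z)
        = ennreal (kernel_u \<mu> P V (Suc n) x z) * ennreal ?k"
      using k nonneg by (subst ennreal_mult[symmetric]) (auto simp: mult.assoc)
    also have "\<dots> \<le> ennreal (lam ^ n / (V x * \<mu> z)) * ?p n x z * ennreal ?k"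
      by (intro mult_right_mono Suc) auto
    also have "\<dots> = ennreal (lam ^ n / (V x * \<mu> z) * ?k) * ?p n x z"
      using k V[of x] \<mu>[of z] lam by (subst ennreal_mult) (auto simp: ac_simps)
    also have "lam ^ n / (V x * \<mu> z) * ?k
        = lam ^ Suc n / (V x * \<mu> y) * (1 / (lam * V z) * P z y)"
      using V[of x] V[of z] \<mu>[of y] \<mu>[of z] lam by (simp add: field_simps)
    also have "ennreal \<dots> = ennreal (lam ^ Suc n / (V x * \<mu> y)) *
        (ennreal (1 / (lam * V z)) * ennreal (P z y))"
      using V[of x] V[of z] \<mu>[of y] lam P[of z y]
      by (subst ennreal_mult[symmetric], simp, simp, subst ennreal_mult[symmetric]) auto
    finally show "ennreal (kernel_u \<mu> P V (Suc n) x z * kernel_u \<mu> P V (Suc 0) z y * \<mu> z)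
        \<le> ennreal (lam ^ Suc n / (V x * \<mu> y)) *
          (?p n x z * ennreal (1 / (lam * V z)) * ennreal (P z y))"
      by (simp only: ac_simps)
  qed
  also have "\<dots> = ennreal (lam ^ Suc n / (V x * \<mu> y)) * ?p (Suc n) x y"
    by (simp add: nn_integral_cmult)
  finally show ?case .
qed

theorem theorem4p4:
  fixes P Ph :: "'a \<Rightarrow> 'a \<Rightarrow> real"
    and \<mu> V :: "'a \<Rightarrow> real"
    and \<phi>0 \<phi>h0 :: "'a \<Rightarrow> real"
    and lam0 Cstar Cminus C :: real
    and x0 :: 'a
    and B Dn A :: "nat \<Rightarrow> 'a set"
    and D :: "'a set"
    and l :: "nat \<Rightarrow> enat"
  assumes X_countable: "countable (UNIV :: 'a set)"
    and X_infinite: "infinite (UNIV :: 'a set)"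
    and P_kernel: "subprob_kernel P"
    and Ph_kernel: "subprob_kernel Ph"
    and mu_pos: "\<And>x. 0 < \<mu> x"
    and duality: "\<And>x y. \<mu> x * P x y = \<mu> y * Ph y x"
    and V_potential: "potential V"
    and lam0_def: "lam0 = lambda0 \<mu> P V"
    and phi0_pos: "\<And>x. 0 < \<phi>0 x"
    and phi0_l2: "\<phi>0 \<in> l2 \<mu>"
    and phi0_norm: "l2_norm \<mu> \<phi>0 = 1"
    and phi0_eigen: "\<And>x. op_U P V \<phi>0 x = lam0 * \<phi>0 x"
    and phih0_pos: "\<And>x. 0 < \<phi>h0 x"
    and phih0_l2: "\<phi>h0 \<in> l2 \<mu>"
    and phih0_norm: "l2_norm \<mu> \<phi>h0 = 1"
    and phih0_eigen: "\<And>x. op_U_hat Ph V \<phi>h0 x = lam0 * \<phi>h0 x"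
    and P_pos: "\<And>x y. 0 < P x y"
    and Cstar_ge: "1 \<le> Cstar"
    and P2_le: "\<And>x y. two_step P x y \<le> Cstar * P x y"
    and Cminus_def: "Cminus = (INF x. P x x)"
    and Cminus_pos: "0 < Cminus"
    and p_bounded: "bdd_above (range (\<lambda>(x, y). P x y / \<mu> y))"
    and V_confining: "confining V"
    and B_exhausting: "exhausting B"
    and B_finite: "\<And>n. 1 \<le> n \<Longrightarrow> finite (B n)"
    and V_increasing: "increasing_wrt V B"
    and C_def: "C = max (3 * Cstar) (1 / Cminus)"
    and D_finite: "finite D"
    and D_superset: "{z. lam0 * V z \<le> C} \<subseteq> D"
    and Dn_def: "\<And>n. 2 \<le> n \<Longrightarrow>
      Dn n = D \<union> {z. lam0 * V z \<ge> C * (1 / (P z x0 * P x0 z)) powr (1 / (real n - 1))}"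
    and l_def: "\<And>n. 2 \<le> n \<Longrightarrow> l n = largest_index B (Dn n)"
    and A_1: "A 1 = B 1"
    and A_n: "\<And>n. 2 \<le> n \<Longrightarrow> A n = with_infinity B (l n)"
  shows "exhausting A
    \<and> (\<exists>c>0. \<forall>n\<ge>1. \<forall>x y. x \<in> A n \<or> y \<in> A n \<longrightarrow>
          kernel_u \<mu> P V n x y \<le> c * lam0 ^ n * \<phi>0 x * \<phi>h0 y)
    \<and> pIUC (kernel_u \<mu> P V) lam0 \<phi>0 \<phi>h0 A
    \<and> pIUC (kernel_u_hat \<mu> P V) lam0 \<phi>h0 \<phi>0 A"
proof -
  have P_nonneg: "0 \<le> P x y" for x y using P_pos less_imp_le by blast
  have P_sum: "P x summable_on UNIV" for x using P_kernel by (simp add: subprob_kernel_def)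
  have P_le_1: "P x y \<le> 1" for x y using P_kernel by (simp add: subprob_kernel_def)
  have V_pos: "0 < V x" for x using V_potential by (simp add: potential_def)
  have C_pos: "0 < C" and C_ge: "3 * Cstar \<le> C" using Cstar_ge C_def by auto

  \<comment> \<open>Pointwise bounds from the eigenfunction equations\<close>
  have P_phi_sum: "(\<lambda>y. P x y * \<phi>0 y) summable_on UNIV" for x
  proof -
    obtain M where M: "\<And>x y. P x y / \<mu> y \<le> M" using p_bounded by (auto simp: bdd_above_def)
    have "(\<lambda>y. P x y + M * ((norm (\<phi>0 y))\<^sup>2 * \<mu> y)) summable_on UNIV"
      using phi0_l2 by (intro summable_on_add summable_on_cmult_right P_sum) (simp add: l2_def)
    then show ?thesis
    proof (rule summable_on_comparison_test)
      fix y
      \<comment> \<open>This splits the sum into one controlled by the mass of \<open>P x\<close>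
        and one controlled by the norm of \<open>\<phi>0\<close>, using that
        \<open>P x y / \<mu> y\<close> is bounded.\<close>
      have "\<phi>0 y \<le> 1 + (\<phi>0 y)\<^sup>2"
        using sum_power2_ge_zero[of "\<phi>0 y - 1" "\<phi>0 y"] zero_le_power2[of "\<phi>0 y - 1"] phi0_pos[of y]
        by (simp add: power2_eq_square algebra_simps)
      then have "P x y * \<phi>0 y \<le> P x y * (1 + (\<phi>0 y)\<^sup>2)" by (intro mult_left_mono P_nonneg)
      also have "\<dots> = P x y + P x y * (\<phi>0 y)\<^sup>2" by (simp add: distrib_left)
      also have "P x y * (\<phi>0 y)\<^sup>2 \<le> (M * \<mu> y) * (\<phi>0 y)\<^sup>2"
        using M[of x y] mu_pos[of y] by (intro mult_right_mono) (auto simp: field_simps)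
      finally show "P x y * \<phi>0 y \<le> P x y + M * ((norm (\<phi>0 y))\<^sup>2 * \<mu> y)"
        by (simp add: ac_simps)
    qed (simp add: P_nonneg phi0_pos less_imp_le)
  qed
  have phi_eq: "(\<Sum>\<^sub>\<infinity>y. P x y * \<phi>0 y) = lam0 * V x * \<phi>0 x" for x
    using phi0_eigen[of x] V_pos[of x] by (simp add: op_U_def field_simps)
  have phi_ge: "P x y * \<phi>0 y \<le> lam0 * V x * \<phi>0 x" for x y
    using finite_sum_le_infsum[OF P_phi_sum, of "{y}" x] P_nonneg phi0_pos
    by (simp add: phi_eq less_imp_le)
  \<comment> \<open>Positivity is read off the eigenvalue equation at \<open>x0\<close>, whose left
    side contains the positive term \<open>P x0 x0 * \<phi>0 x0\<close>.\<close>
  have lam0_pos: "0 < lam0"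
  proof -
    have "0 < P x0 x0 * \<phi>0 x0" using P_pos phi0_pos by simp
    then have "0 < lam0 * (V x0 * \<phi>0 x0)" using phi_ge[of x0 x0] by (simp add: mult.assoc)
    then show ?thesis by (rule zero_less_mult_pos2[OF _ mult_pos_pos[OF V_pos phi0_pos]])
  qed
  have phih_ge: "P x0 y * \<mu> x0 * \<phi>h0 x0 / (V x0 * \<mu> y) \<le> lam0 * \<phi>h0 y" for y
  proof -
    let ?f = "\<lambda>z. Ph y z * (1 / V z) * \<phi>h0 z"
    have eq: "infsum ?f UNIV = lam0 * \<phi>h0 y" using phih0_eigen[of y] by (simp add: op_U_hat_def)
    \<comment> \<open>A nonzero value of \<open>infsum\<close> cannot be the default one, so the sum
      converges.\<close>
    then have "infsum ?f UNIV \<noteq> 0" using lam0_pos phih0_pos[of y] by simp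
    then have "?f summable_on UNIV" using infsum_not_exists by blast
    moreover have "0 \<le> ?f z" for z
      using Ph_kernel V_pos[of z] phih0_pos[of z] by (simp add: subprob_kernel_def)
    ultimately have "?f x0 \<le> lam0 * \<phi>h0 y"
      using finite_sum_le_infsum[of ?f UNIV "{x0}"] eq by simp
    moreover have "Ph y x0 = \<mu> x0 * P x0 y / \<mu> y"
      using duality[of x0 y] mu_pos[of y] by (simp add: field_simps)
    ultimately show ?thesis by (simp add: ac_simps)
  qed

  \<comment> \<open>Translation into path sums\<close>
  define Q where "Q = (\<lambda>x y. ennreal (P x y))"
  define w where "w = (\<lambda>z. ennreal (1 / (lam0 * V z)))"
  \<comment> \<open>Multiplying \<open>\<phi>0\<close> by \<open>lam0 * V\<close> turns its
    eigenvalue equation into the fixed-point equation \<open>eig\<close>.\<close>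
  define \<psi> where "\<psi> = (\<lambda>x. ennreal (lam0 * V x * \<phi>0 x))"
  have PP_sum: "(\<lambda>z. P x z * P z y) summable_on UNIV" for x y
    by (rule summable_on_comparison_test[OF P_sum[of x]])
      (use P_nonneg P_le_1 in \<open>auto simp: mult_left_le\<close>)
  interpret two_step_regular Q "ennreal Cstar"
  proof
    fix x y
    have "esum (\<lambda>z. Q x z * Q z y) = ennreal (two_step P x y)"
      using esum_ennreal[OF PP_sum[of x y]] P_nonneg
      by (simp add: Q_def two_step_def ennreal_mult)
    also have "\<dots> \<le> ennreal (Cstar * P x y)" by (intro ennreal_leI P2_le)
    finally show "esum (\<lambda>z. Q x z * Q z y) \<le> ennreal Cstar * Q x y"
      using Cstar_ge P_nonneg by (simp add: Q_def ennreal_mult)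
  qed
  have PP_le: "P x z * P z y \<le> Cstar * P x y" for x y z
    using finite_sum_le_infsum[OF PP_sum[of x y], of "{z}"] P2_le[of x y] P_nonneg
    by (simp add: two_step_def)
  have eig: "\<psi> x = esum (\<lambda>z. Q x z * w z * \<psi> z)" for x
  proof -
    have "esum (\<lambda>z. Q x z * w z * \<psi> z) = esum (\<lambda>z. ennreal (P x z * \<phi>0 z))"
      using P_nonneg phi0_pos V_pos lam0_pos
      by (intro nn_integral_cong)
        (simp add: Q_def w_def \<psi>_def ennreal_mult[symmetric] less_imp_le
          V_pos[THEN dual_order.strict_implies_not_eq])
    also have "\<dots> = \<psi> x"
      using esum_ennreal[OF P_phi_sum[of x]] P_nonneg phi0_pos
      by (simp add: phi_eq \<psi>_def less_imp_le)
    finally show ?thesis by simp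
  qed

  \<comment> \<open>The finite exceptional set\<close>
  \<comment> \<open>\<open>B 1\<close> is included because it equals \<open>A 1\<close> and because
    \<open>A n\<close> may exceed \<open>Dn n\<close> by points of \<open>B 1\<close>;
    \<open>x0\<close> makes the set nonempty, which yields \<open>K_nonneg\<close>.\<close>
  define D' where "D' = insert x0 (D \<union> B 1)"
  \<comment> \<open>From \<open>P x d * P d x0 \<le> Cstar * P x x0\<close>, a step to
    \<open>d\<close> can be exchanged for a step to \<open>x0\<close> at cost
    \<open>Cstar / P d x0\<close>; steps from \<open>d\<close> are treated likewise. The sum
    dominates all these costs.\<close>
  define K where "K = (\<Sum>d\<in>D'. Cstar / P d x0 + Cstar / P x0 d)"
  have D': "finite D'" using D_finite B_finite by (simp add: D'_def)
  have K_ge: "Cstar / P d x0 \<le> K" "Cstar / P x0 d \<le> K" if "d \<in> D'" for d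
  proof -
    have nonneg: "0 \<le> Cstar / P d x0" "0 \<le> Cstar / P x0 d" for d
      using Cstar_ge P_nonneg by simp_all
    have "Cstar / P d x0 + Cstar / P x0 d \<le> K"
      unfolding K_def using D' that nonneg by (intro member_le_sum add_nonneg_nonneg) auto
    then show "Cstar / P d x0 \<le> K" "Cstar / P x0 d \<le> K" using nonneg[of d] by linarith+
  qed
  have K_nonneg: "0 \<le> K"
    using K_ge(1)[of x0] Cstar_ge P_nonneg[of x0 x0] by (auto simp: D'_def elim: order_trans[rotated])
  have P_D: "P x d \<le> K * P x x0" "P d y \<le> K * P x0 y" if "d \<in> D'" for x y d
  proof -
    have "P x d \<le> Cstar / P d x0 * P x x0" using PP_le[of x d x0] P_pos[of d x0] by (simp add: field_simps)
    also have "\<dots> \<le> K * P x x0" by (intro mult_right_mono K_ge that P_nonneg)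
    finally show "P x d \<le> K * P x x0" .
    have "P d y \<le> Cstar / P x0 d * P x0 y" using PP_le[of x0 d y] P_pos[of x0 d] by (simp add: field_simps)
    also have "\<dots> \<le> K * P x0 y" by (intro mult_right_mono K_ge that P_nonneg)
    finally show "P d y \<le> K * P x0 y" .
  qed
  have one_le: "1 \<le> K * P d x0" "1 \<le> K * P x0 d" if "d \<in> D'" for d
    using K_ge[OF that] Cstar_ge P_pos[of d x0] P_pos[of x0 d] by (auto simp: field_simps)
  have Q_D: "Q x d \<le> ennreal K * Q x x0" "Q d y \<le> ennreal K * Q x0 y" if "d \<in> D'" for x y d
    using P_D[OF that] K_nonneg P_nonneg
    by (simp_all add: Q_def ennreal_mult[symmetric])

  have large: "C < lam0 * V z" if "z \<notin> D'" for z
    using that D_superset by (force simp: D'_def not_le[symmetric])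
  define v where "v = (\<lambda>z. w z * indicator (- D') z)"
  have w_le: "w z \<le> ennreal (1 / C)" if "z \<notin> D'" for z
    unfolding w_def using large[OF that] C_pos by (intro ennreal_leI divide_left_mono) auto
  then have v_le: "v z \<le> ennreal (1 / C)" for z by (simp add: v_def split: split_indicator)
  have bc: "ennreal (1 / C) * ennreal Cstar = ennreal (Cstar / C)"
    using C_pos Cstar_ge by (simp add: ennreal_mult[symmetric])
  have "3 * ennreal (Cstar / C) = ennreal (3 * (Cstar / C))"
    using C_pos Cstar_ge by (subst ennreal_mult) auto
  also have "\<dots> \<le> 1" using C_ge C_pos by (simp add: field_simps)
  finally have b: "3 * (ennreal (1 / C) * ennreal Cstar) \<le> 1" by (simp add: bc)
  obtain L where L: "L < top"
    "\<And>n x y. path_kernel Q w n x y \<le> path_kernel Q v n x y + L * Q x x0 * Q x0 y"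
  proof (rule path_kernel_le_avoiding[OF D' Q_D _ w_le b _ eig])
    show "\<psi> x \<noteq> 0" for x
      unfolding \<psi>_def using lam0_pos V_pos[of x] phi0_pos[of x] by (simp add: not_le)
  qed (auto simp: \<psi>_def w_def v_def)

  \<comment> \<open>Paths avoiding the exceptional set\<close>
  have A_sub: "A n \<subseteq> Dn n \<union> B 1" if "2 \<le> n" for n
    using with_infinity_largest_index_subset[OF B_exhausting] that by (simp add: A_n l_def)
  have Dn_bound: "w z ^ Suc k \<le> ennreal ((1 / C) ^ Suc k) * (Q z x0 * Q x0 z)"
    if z: "z \<in> A (Suc (Suc k))" "z \<notin> D'" for z k
  proof -
    \<comment> \<open>Avoiding \<open>D'\<close> rules out both \<open>B 1\<close> and
      \<open>D\<close>, so membership in \<open>Dn\<close> comes from the threshold condition, whose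
      exponent is \<open>1 / Suc k\<close>.\<close>
    have "z \<in> Dn (Suc (Suc k)) - D" using A_sub[of "Suc (Suc k)"] z by (auto simp: D'_def)
    then have "C * (1 / (P z x0 * P x0 z)) powr (1 / real (Suc k)) \<le> lam0 * V z"
      by (auto simp: Dn_def)
    then have "(1 / (lam0 * V z)) ^ Suc k \<le> (1 / C) ^ Suc k * (P z x0 * P x0 z)"
      by (rule power_le_of_powr_le[OF C_pos mult_pos_pos[OF P_pos P_pos]])
    then have "ennreal ((1 / (lam0 * V z)) ^ Suc k)
        \<le> ennreal ((1 / C) ^ Suc k * (P z x0 * P x0 z))" by (rule ennreal_leI)
    moreover have "ennreal ((1 / (lam0 * V z)) ^ Suc k) = w z ^ Suc k"
      unfolding w_def using lam0_pos V_pos[of z] by (intro ennreal_power[symmetric]) simp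
    moreover have "ennreal ((1 / C) ^ Suc k * (P z x0 * P x0 z))
        = ennreal ((1 / C) ^ Suc k) * (Q z x0 * Q x0 z)"
      unfolding Q_def using C_pos P_nonneg by (subst ennreal_mult, simp, simp, subst ennreal_mult) auto
    ultimately show ?thesis by simp
  qed

  \<comment> \<open>The first summand serves an endpoint in \<open>D'\<close>, the second the
    rank-one bound for endpoints outside \<open>D'\<close>.\<close>
  define E where "E = ennreal (K\<^sup>2) + 2 * (ennreal Cstar)\<^sup>2"
  have avoid: "path_kernel Q v n x y \<le> E * Q x x0 * Q x0 y"
    if xy: "x \<in> A (Suc n) \<or> y \<in> A (Suc n)" for n x y
  proof (cases "x \<in> D' \<or> y \<in> D'")
    case True
    \<comment> \<open>If \<open>x\<close> lies in \<open>D'\<close>, then \<open>K * P x x0\<close>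
      is at least 1 and \<open>K * P x0 y\<close> dominates \<open>P x y\<close>; the case of
      \<open>y\<close> is symmetric.\<close>
    have "P x y \<le> K\<^sup>2 * P x x0 * P x0 y"
      using True
    proof
      assume "x \<in> D'"
      then have "1 * P x y \<le> (K * P x x0) * (K * P x0 y)"
        by (intro mult_mono one_le P_D mult_nonneg_nonneg K_nonneg P_nonneg)
      then show ?thesis by (simp add: power2_eq_square ac_simps)
    next
      assume "y \<in> D'"
      then have "P x y * 1 \<le> (K * P x x0) * (K * P x0 y)"
        by (intro mult_mono one_le P_D mult_nonneg_nonneg K_nonneg P_nonneg) auto
      then show ?thesis by (simp add: power2_eq_square ac_simps)
    qed
    then have Q: "Q x y \<le> ennreal (K\<^sup>2) * Q x x0 * Q x0 y"
      using P_nonneg by (simp add: Q_def ennreal_mult[symmetric])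
    have "Cstar / C \<le> 1" using C_ge C_pos Cstar_ge by simp
    then have "(ennreal (1 / C) * ennreal Cstar) ^ n \<le> 1"
      unfolding bc by (intro power_le_one) auto
    then have "(ennreal (1 / C) * ennreal Cstar) ^ n * Q x y \<le> 1 * Q x y"
      by (intro mult_right_mono) auto
    then have "path_kernel Q v n x y \<le> Q x y"
      using path_kernel_le[of v, OF v_le, of n x y] by simp
    also note Q
    also have "ennreal (K\<^sup>2) * Q x x0 * Q x0 y \<le> E * Q x x0 * Q x0 y"
      unfolding E_def by (intro mult_right_mono) auto
    finally show ?thesis .
  next
    case False
    \<comment> \<open>For \<open>n = 0\<close> an endpoint would lie in \<open>A 1 = B 1\<close>,
      hence in \<open>D'\<close>.\<close>
    have "n \<noteq> 0"
    proof
      assume "n = 0"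
      then have "x \<in> B 1 \<or> y \<in> B 1" using xy A_1 by simp
      then show False using False by (auto simp: D'_def)
    qed
    then obtain k where n: "n = Suc k" by (cases n) simp
    \<comment> \<open>\<open>u\<close> is the endpoint in \<open>A (Suc n)\<close>. For an
      intermediate \<open>z\<close> outside that set, \<open>V z\<close> is at least
      \<open>V u\<close>, so the weight at \<open>u\<close> can replace the one at
      \<open>z\<close>.\<close>
    obtain u where u: "u = x \<or> u = y" "u \<in> A (Suc n)" "u \<notin> D'" using xy False by blast
    let ?r = "ennreal ((1 / C) ^ Suc k)"
    have v_pow: "v z ^ Suc k \<le> ?r * (Q z x0 * Q x0 z + Q u x0 * Q x0 u)" for z
    proof (cases "z \<in> D'")
      case False
      then have vw: "v z = w z" by (simp add: v_def)
      show ?thesis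
      proof (cases "z \<in> A (Suc n)")
        case True
        have "v z ^ Suc k \<le> ?r * (Q z x0 * Q x0 z)"
          unfolding vw using True False n by (intro Dn_bound) auto
        also have "\<dots> \<le> ?r * (Q z x0 * Q x0 z + Q u x0 * Q x0 u)" by (intro mult_left_mono) auto
        finally show ?thesis .
      next
        case notA: False
        have "V u \<le> V z"
        proof (rule increasing_wrt_with_infinity[OF B_exhausting V_increasing])
          show "1 \<le> l (Suc n)" using n by (simp add: l_def one_le_largest_index)
          show "u \<in> with_infinity B (l (Suc n))" "z \<notin> with_infinity B (l (Suc n))"
            using u(2) notA n by (simp_all add: A_n)
        qed
        then have "v z \<le> w u"
          unfolding vw w_def using lam0_pos V_pos[of u] V_pos[of z]
          by (intro ennreal_leI divide_left_mono mult_left_mono) auto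
        then have "v z ^ Suc k \<le> w u ^ Suc k" by (intro power_mono) auto
        also have "\<dots> \<le> ?r * (Q u x0 * Q x0 u)" using u n by (intro Dn_bound) auto
        also have "\<dots> \<le> ?r * (Q z x0 * Q x0 z + Q u x0 * Q x0 u)" by (intro mult_left_mono) auto
        finally show ?thesis .
      qed
    qed (simp add: v_def)
    \<comment> \<open>Since \<open>C \<ge> 3 * Cstar\<close>, both \<open>2 * Cstar / C\<close> and
      \<open>1 / C\<close> are at most 1.\<close>
    have "(2 * Cstar) ^ k * (1 / C) ^ Suc k = (2 * Cstar / C) ^ k * (1 / C)"
      by (simp add: power_divide)
    also have "\<dots> \<le> 1 * 1"
      using C_ge C_pos Cstar_ge by (intro mult_mono power_le_one) (auto simp: field_simps)
    finally have real: "(2 * Cstar) ^ k * (1 / C) ^ Suc k \<le> 1" by simp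
    have "(2 * ennreal Cstar) ^ k = ennreal ((2 * Cstar) ^ k)"
      using Cstar_ge by (subst ennreal_power[symmetric]) (auto simp: ennreal_mult)
    then have "(2 * ennreal Cstar) ^ k * ?r = ennreal ((2 * Cstar) ^ k * (1 / C) ^ Suc k)"
      using C_pos Cstar_ge by (simp only:) (intro ennreal_mult[symmetric]; simp)
    also have "\<dots> \<le> ennreal 1" by (intro ennreal_leI real)
    finally have r: "(2 * ennreal Cstar) ^ k * ?r \<le> 1" unfolding ennreal_1 .
    have "path_kernel Q v n x y \<le> 2 * (ennreal Cstar)\<^sup>2 * Q x x0 * Q x0 y"
      unfolding n by (rule path_kernel_Suc_le_rank_one[OF v_pow u(1) r])
    also have "\<dots> \<le> E * Q x x0 * Q x0 y"
      unfolding E_def by (intro mult_right_mono) auto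
    finally show ?thesis .
  qed

  \<comment> \<open>From path sums to the eigenfunctions\<close>
  define G where "G = enn2real (E + L)"
  have EL: "E + L = ennreal G"
    using L(1) by (simp add: G_def E_def ennreal_enn2real_if less_top ennreal_mult_eq_top_iff power_eq_top_ennreal)
  have G_nonneg: "0 \<le> G" by (simp add: G_def)
  \<comment> \<open>The fraction collects the factors at \<open>x0\<close> from replacing
    \<open>P x x0\<close> and \<open>P x0 y\<close> by eigenfunctions. Each replacement yields a
    \<open>lam0\<close>: one completes \<open>lam0 ^ n\<close>, the other stays in \<open>c\<close>.
    Using \<open>G + 1\<close> makes \<open>c\<close> positive.\<close>
  define c where "c = (G + 1) * (lam0 * V x0 / (\<phi>0 x0 * \<mu> x0 * \<phi>h0 x0))"
  have c_pos: "0 < c"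
    unfolding c_def using G_nonneg lam0_pos V_pos phi0_pos phih0_pos mu_pos
    by (intro mult_pos_pos divide_pos_pos) auto
  have main: "kernel_u \<mu> P V n x y \<le> c * lam0 ^ n * \<phi>0 x * \<phi>h0 y"
    if n: "1 \<le> n" and xy: "x \<in> A n \<or> y \<in> A n" for n x y
  proof -
    obtain m where m: "n = Suc m" using n by (cases n) auto
    have "path_kernel Q w m x y \<le> E * Q x x0 * Q x0 y + L * Q x x0 * Q x0 y"
      using L(2)[of m x y] avoid[of x m y] xy unfolding m by (meson add_right_mono order_trans)
    also have "\<dots> = ennreal (G * P x x0 * P x0 y)"
      unfolding distrib_right[symmetric] EL using G_nonneg P_nonneg by (simp add: Q_def ennreal_mult)
    finally have path: "path_kernel Q w m x y \<le> ennreal (G * P x x0 * P x0 y)" .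
    let ?s = "lam0 ^ m / (V x * \<mu> y)"
    have s: "0 \<le> ?s" using lam0_pos V_pos[of x] mu_pos[of y] by simp
    have "ennreal (kernel_u \<mu> P V n x y) \<le> ennreal ?s * path_kernel Q w m x y"
      unfolding m Q_def w_def using kernel_u_le_path_kernel[OF P_nonneg mu_pos V_pos lam0_pos] .
    also have "\<dots> \<le> ennreal ?s * ennreal (G * P x x0 * P x0 y)" by (intro mult_left_mono path) auto
    also have "\<dots> = ennreal (?s * (G * P x x0 * P x0 y))" using s by (rule ennreal_mult'[symmetric])
    finally have "kernel_u \<mu> P V n x y \<le> ?s * (G * P x x0 * P x0 y)"
      by (subst (asm) ennreal_le_iff) (intro mult_nonneg_nonneg s G_nonneg P_nonneg)
    also have "\<dots> \<le> ?s * ((G + 1) * P x x0 * P x0 y)"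
      using s P_nonneg by (intro mult_left_mono mult_right_mono) auto
    also have "\<dots> = lam0 ^ m * (G + 1) / V x * P x x0 * (P x0 y / \<mu> y)" by simp
    also have "\<dots> \<le> lam0 ^ m * (G + 1) / V x * (lam0 * V x * \<phi>0 x / \<phi>0 x0) *
        (lam0 * \<phi>h0 y * V x0 / (\<mu> x0 * \<phi>h0 x0))"
    proof (intro mult_mono)
      show "P x x0 \<le> lam0 * V x * \<phi>0 x / \<phi>0 x0"
        using phi_ge[of x x0] phi0_pos[of x0] by (simp add: field_simps)
      show "P x0 y / \<mu> y \<le> lam0 * \<phi>h0 y * V x0 / (\<mu> x0 * \<phi>h0 x0)"
        using phih_ge[of y] mu_pos[of x0] mu_pos[of y] V_pos[of x0] phih0_pos[of x0]
        by (simp add: field_simps)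
    qed (use lam0_pos V_pos[of x] G_nonneg P_nonneg mu_pos[of y] phi0_pos[of x] phi0_pos[of x0]
        in \<open>simp_all add: less_imp_le\<close>)
    also have "\<dots> = c * lam0 ^ n * \<phi>0 x * \<phi>h0 y"
      using V_pos[of x] phi0_pos[of x0] mu_pos[of x0] phih0_pos[of x0]
      by (simp add: c_def m field_simps)
    finally show ?thesis .
  qed

  \<comment> \<open>Exhaustion and progressive ultracontractivity\<close>
  have "exhausting A"
  proof (rule exhausting_largest_index[OF B_exhausting B_finite])
    show "Dn n \<subseteq> Dn (Suc n)" if n: "2 \<le> n" for n
    proof
      fix z assume z: "z \<in> Dn n"
      have "P z x0 * P x0 z \<le> 1" by (intro mult_le_one P_le_1 P_nonneg)
      \<comment> \<open>With base at least 1 the smaller exponent lowers the threshold, so the sets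
        \<open>Dn n\<close> increase.\<close>
      then have q: "1 \<le> 1 / (P z x0 * P x0 z)" using P_pos by simp
      have "(1 / (P z x0 * P x0 z)) powr (1 / (real (Suc n) - 1))
          \<le> (1 / (P z x0 * P x0 z)) powr (1 / (real n - 1))"
        using n q by (intro powr_mono divide_left_mono) auto
      then have "C * (1 / (P z x0 * P x0 z)) powr (1 / (real (Suc n) - 1))
          \<le> C * (1 / (P z x0 * P x0 z)) powr (1 / (real n - 1))"
        using C_pos by (intro mult_left_mono) auto
      moreover have "2 \<le> Suc n" using n by simp
      ultimately show "z \<in> Dn (Suc n)"
        using z by (simp only: Dn_def n Un_iff mem_Collect_eq) (blast intro: order_trans)
    qed
    show "\<exists>n\<ge>2. z \<in> Dn n" for z
    proof (cases "z \<in> D")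
      case True
      then show ?thesis using Dn_def[OF order_refl] by auto
    next
      case False
      then have "C < lam0 * V z" using D_superset not_le by blast
      have "0 < 1 / (P z x0 * P x0 z)" using P_pos by simp
      then obtain n :: nat where
        "2 \<le> n" "C * (1 / (P z x0 * P x0 z)) powr (1 / (real n - 1)) \<le> lam0 * V z"
        using \<open>C < lam0 * V z\<close> by (rule threshold_eventually_less)
      then show ?thesis using Dn_def[of n] by auto
    qed
    show "A n = with_infinity B (largest_index B (Dn n))" if "2 \<le> n" for n
      using that by (simp add: A_n l_def)
  qed (use A_1 in simp_all)
  moreover have "\<exists>c>0. \<forall>n\<ge>1. \<forall>x y. x \<in> A n \<or> y \<in> A n \<longrightarrow>
      kernel_u \<mu> P V n x y \<le> c * lam0 ^ n * \<phi>0 x * \<phi>h0 y"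
    by (intro exI[of _ c] conjI allI impI c_pos main)
  moreover have "pIUC (kernel_u \<mu> P V) lam0 \<phi>0 \<phi>h0 A"
    unfolding pIUC_def
    by (intro exI[of _ "1::nat"] exI[of _ c] conjI allI ballI impI order_refl c_pos main disjI1)
  moreover have "pIUC (kernel_u_hat \<mu> P V) lam0 \<phi>h0 \<phi>0 A"
    unfolding pIUC_def kernel_u_hat_def
  proof (intro exI[of _ "1::nat"] exI[of _ c] conjI allI ballI impI order_refl c_pos)
    fix n x y assume "1 \<le> n" "x \<in> A n"
    then show "kernel_u \<mu> P V n y x \<le> c * lam0 ^ n * \<phi>h0 x * \<phi>0 y"
      \<comment> \<open>The adjoint kernel swaps its arguments, so here the second point of
        \<open>main\<close> is the one in \<open>A n\<close>.\<close>
      using main[of n y x] by (simp add: ac_simps)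
  qed
  ultimately show ?thesis by blast
qed

end
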